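(* Let $A$ be a countable-dimensional locally matrix algebra over a field $\mathbb{F}$. Then $$\dim_{\mathbb{F}}\mathrm{Der}(A)=\dim_{\mathbb{F}}\mathrm{Outder}(A)=|\mathbb{F}|^{\aleph_0}.$$
   Context: An associative $\mathbb{F}$-algebra $A$ (not necessarily with unit) is a locally matrix algebra if every finite subset of $A$ is contained in a subalgebra $B\subset A$ with $B\cong M_n(\mathbb{F})$ for some $n$. Countable-dimensional means of dimension $\aleph_0$ over $\mathbb{F}$. $\mathrm{Der}(A)$ is the Lie algebra of all $\mathbb{F}$-linear derivations of $A$, $\mathrm{Inder}(A)$ is its ideal of inner derivations $x\mapsto[a,x]=ax-xa$, $a\in A$, and $\mathrm{Outder}(A)=\mathrm{Der}(A)/\mathrm{Inder}(A)$. $|\mathbb{F}|$ is the cardinality of $\mathbb{F}$, $\aleph_0$ is the countable cardinality, and $|X|^{|Y|}$ is the cardinality of the set of all maps $Y\to X$. Dimensions are cardinal numbers. *)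

theory Defs
  imports
    "HOL-Algebra.QuotRing"
    "Jordan_Normal_Form.Matrix"
    "Jordan_Normal_Form.VS_Connect"
begin

unbundle cardinal_syntax

text \<open>Cardinals are the well-orders of HOL's cardinal library: equality of cardinals is \<open>=o\<close>, and
  \<open>natLeq\<close> is the countable cardinal. The library's \<open>vectorspace.dim\<close> is a natural number, so the
  dimension as a cardinal is the cardinality of a basis; all bases are equipotent.\<close>

definition dimension :: "('k, 'm) ring_scheme \<Rightarrow> ('k, 'v, 'n) module_scheme \<Rightarrow> 'v rel" where
  "dimension K V = |SOME B. vectorspace.basis K V B|"

text \<open>The record fields \<open>mult\<close> and \<open>one\<close> of a module record play no role in its linear
  structure.\<close>

definition quotient_module :: "('k, 'v, 'n) module_scheme \<Rightarrow> 'v set \<Rightarrow> ('k, 'v set) module" where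
  "quotient_module M N =
    \<lparr>carrier = a_rcosets\<^bsub>M\<^esub> N, mult = rcoset_mult M N, one = N +>\<^bsub>M\<^esub> \<one>\<^bsub>M\<^esub>,
     zero = N, add = set_add M,
     smult = (\<lambda>c X. \<Union>x\<in>X. N +>\<^bsub>M\<^esub> (c \<odot>\<^bsub>M\<^esub> x))\<rparr>"

text \<open>The type class \<open>ring\<close> does not require a unit.\<close>

locale associative_algebra = vector_space scale
  for scale :: "'f::field \<Rightarrow> 'a::ring \<Rightarrow> 'a" (infixr \<open>*s\<close> 75) +
  assumes scale_mult_left: "(c *s x) * y = c *s (x * y)"
    and scale_mult_right: "x * (c *s y) = c *s (x * y)"
begin

definition subalgebra :: "'a set \<Rightarrow> bool" where
  "subalgebra B \<longleftrightarrow> subspace B \<and> (\<forall>x\<in>B. \<forall>y\<in>B. x * y \<in> B)"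

definition matrix_iso :: "nat \<Rightarrow> 'a set \<Rightarrow> ('a \<Rightarrow> 'f mat) \<Rightarrow> bool" where
  "matrix_iso n B \<phi> \<longleftrightarrow> bij_betw \<phi> B (carrier_mat n n) \<and>
     (\<forall>x\<in>B. \<forall>y\<in>B. \<phi> (x + y) = \<phi> x + \<phi> y \<and> \<phi> (x * y) = \<phi> x * \<phi> y) \<and>
     (\<forall>c. \<forall>x\<in>B. \<phi> (c *s x) = c \<cdot>\<^sub>m \<phi> x)"

definition derivation :: "('a \<Rightarrow> 'a) \<Rightarrow> bool" where
  "derivation d \<longleftrightarrow> Vector_Spaces.linear scale scale d \<and> (\<forall>x y. d (x * y) = d x * y + x * d y)"

end

locale locally_matrix_algebra = associative_algebra +
  assumes locally_matrix:
    "finite S \<Longrightarrow> \<exists>B n \<phi>. S \<subseteq> B \<and> subalgebra B \<and> n \<ge> 1 \<and> matrix_iso n B \<phi>"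

definition algebra_module :: "('f::field \<Rightarrow> 'a::ring \<Rightarrow> 'a) \<Rightarrow> ('f, 'a) module" where
  "algebra_module scale =
    \<lparr>carrier = UNIV, mult = (*), one = 0, zero = 0, add = (+), smult = scale\<rparr>"

text \<open>The multiplication of the record is the Lie bracket; a Lie algebra has no unit, and \<open>one\<close> is
  filled with zero.\<close>

definition Der :: "('f::field \<Rightarrow> 'a::ring \<Rightarrow> 'a) \<Rightarrow> ('f, 'a \<Rightarrow> 'a) module" where
  "Der scale =
    \<lparr>carrier = Collect (associative_algebra.derivation scale),
     mult = (\<lambda>d e x. d (e x) - e (d x)),
     one = (\<lambda>x. 0), zero = (\<lambda>x. 0), add = (\<lambda>d e x. d x + e x),
     smult = (\<lambda>c d x. scale c (d x))\<rparr>"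

definition inner_derivation :: "'a::ring \<Rightarrow> 'a \<Rightarrow> 'a" where
  "inner_derivation a = (\<lambda>x. a * x - x * a)"

definition Inder :: "('a::ring \<Rightarrow> 'a) set" where
  "Inder = range inner_derivation"

definition Outder :: "('f::field \<Rightarrow> 'a::ring \<Rightarrow> 'a) \<Rightarrow> ('f, ('a \<Rightarrow> 'a) set) module" where
  "Outder scale = quotient_module (Der scale) Inder"

lemma quotient_module_vectorspace:
  assumes V: "vectorspace K V" and N: "submodule K N V"
  shows "vectorspace K (quotient_module V N)"
proof -
  interpret V: vectorspace K V by (rule V)
  interpret N: submodule K N V by (rule N)
  have "additive_subgroup N V"
  proof (rule additive_subgroup.intro, rule V.M.add.subgroupI)
    show "\<ominus>\<^bsub>V\<^esub> x \<in> N" if "x \<in> N" for x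
      using N.smult_closed[OF _ that, of "\<ominus>\<^bsub>K\<^esub> \<one>\<^bsub>K\<^esub>"] N.subset that
      by (metis V.R.add.inv_closed V.R.one_closed V.smult_minus_1 subsetD)
    show "N \<noteq> {}" using N.zero_closed by blast
  qed (use N.subset N.m_closed in auto)
  then interpret S: abelian_subgroup N V
    by (rule abelian_subgroupI3) (rule V.M.abelian_group_axioms)
  have eq: "N +>\<^bsub>V\<^esub> y = N +>\<^bsub>V\<^esub> x" if "y \<in> N +>\<^bsub>V\<^esub> x" "x \<in> carrier V" for x y
    using V.M.a_repr_independence[OF that S.a_subgroup] by (rule sym)
  have sm: "smult (quotient_module V N) c (N +>\<^bsub>V\<^esub> x) = N +>\<^bsub>V\<^esub> (c \<odot>\<^bsub>V\<^esub> x)"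
    if c: "c \<in> carrier K" and x: "x \<in> carrier V" for c x
  proof -
    have "N +>\<^bsub>V\<^esub> (c \<odot>\<^bsub>V\<^esub> y) = N +>\<^bsub>V\<^esub> (c \<odot>\<^bsub>V\<^esub> x)" if y: "y \<in> N +>\<^bsub>V\<^esub> x" for y
    proof -
      obtain n where n: "n \<in> N" "y = n \<oplus>\<^bsub>V\<^esub> x" using y unfolding a_r_coset_def' by auto
      then have "c \<odot>\<^bsub>V\<^esub> y = c \<odot>\<^bsub>V\<^esub> n \<oplus>\<^bsub>V\<^esub> c \<odot>\<^bsub>V\<^esub> x"
        using c x N.subset V.smult_r_distr by auto
      then have "c \<odot>\<^bsub>V\<^esub> y \<in> N +>\<^bsub>V\<^esub> (c \<odot>\<^bsub>V\<^esub> x)"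
        using N.smult_closed[OF c n(1)] unfolding a_r_coset_def' by auto
      then show ?thesis by (rule eq) (intro V.smult_closed c x)
    qed
    then have "(\<Union>y\<in>N +>\<^bsub>V\<^esub> x. N +>\<^bsub>V\<^esub> (c \<odot>\<^bsub>V\<^esub> y)) = N +>\<^bsub>V\<^esub> (c \<odot>\<^bsub>V\<^esub> x)"
      using S.a_rcos_self[OF x] by blast
    then show ?thesis unfolding quotient_module_def module.simps .
  qed
  let ?Q = "quotient_module V N"
  have car: "carrier ?Q = (\<lambda>x. N +>\<^bsub>V\<^esub> x) ` carrier V"
    by (auto simp: quotient_module_def A_RCOSETS_def')
  have ad: "(N +>\<^bsub>V\<^esub> x) \<oplus>\<^bsub>?Q\<^esub> (N +>\<^bsub>V\<^esub> y) = N +>\<^bsub>V\<^esub> (x \<oplus>\<^bsub>V\<^esub> y)"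
    if "x \<in> carrier V" "y \<in> carrier V" for x y
    using S.a_rcos_sum[OF that] by (simp add: quotient_module_def)
  have ze: "\<zero>\<^bsub>?Q\<^esub> = N +>\<^bsub>V\<^esub> \<zero>\<^bsub>V\<^esub>"
    using V.M.a_coset_add_zero[OF N.subset] by (simp add: quotient_module_def)
  have rep: "\<exists>x\<in>carrier V. X = N +>\<^bsub>V\<^esub> x" if "X \<in> carrier ?Q" for X
    using that unfolding car by blast
  have in_Q: "N +>\<^bsub>V\<^esub> x \<in> carrier ?Q" if "x \<in> carrier V" for x
    using that unfolding car by blast
  have "abelian_group ?Q"
  proof (rule abelian_groupI)
    fix X Y assume "X \<in> carrier ?Q" "Y \<in> carrier ?Q"
    then obtain x y where xy: "x \<in> carrier V" "y \<in> carrier V"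
      "X = N +>\<^bsub>V\<^esub> x" "Y = N +>\<^bsub>V\<^esub> y" using rep by meson
    show "X \<oplus>\<^bsub>?Q\<^esub> Y \<in> carrier ?Q"
      unfolding xy ad[OF xy(1,2)] by (intro in_Q V.M.a_closed xy)
    show "X \<oplus>\<^bsub>?Q\<^esub> Y = Y \<oplus>\<^bsub>?Q\<^esub> X"
      unfolding xy ad[OF xy(1,2)] ad[OF xy(2,1)] V.M.a_comm[OF xy(1,2)] ..
  next
    show "\<zero>\<^bsub>?Q\<^esub> \<in> carrier ?Q" unfolding ze by (intro in_Q V.M.zero_closed)
  next
    fix X Y Z assume "X \<in> carrier ?Q" "Y \<in> carrier ?Q" "Z \<in> carrier ?Q"
    then obtain x y z where xyz: "x \<in> carrier V" "y \<in> carrier V" "z \<in> carrier V"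
      "X = N +>\<^bsub>V\<^esub> x" "Y = N +>\<^bsub>V\<^esub> y" "Z = N +>\<^bsub>V\<^esub> z" using rep by meson
    show "X \<oplus>\<^bsub>?Q\<^esub> Y \<oplus>\<^bsub>?Q\<^esub> Z = X \<oplus>\<^bsub>?Q\<^esub> (Y \<oplus>\<^bsub>?Q\<^esub> Z)"
      unfolding xyz ad[OF xyz(1,2)] ad[OF xyz(2,3)] ad[OF V.M.a_closed[OF xyz(1,2)] xyz(3)]
        ad[OF xyz(1) V.M.a_closed[OF xyz(2,3)]] V.M.a_assoc[OF xyz(1,2,3)] ..
  next
    fix X assume "X \<in> carrier ?Q"
    then obtain x where x: "x \<in> carrier V" "X = N +>\<^bsub>V\<^esub> x" using rep by meson
    show "\<zero>\<^bsub>?Q\<^esub> \<oplus>\<^bsub>?Q\<^esub> X = X"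
      unfolding ze x(2) ad[OF V.M.zero_closed x(1)] V.M.l_zero[OF x(1)] ..
    have "(N +>\<^bsub>V\<^esub> (\<ominus>\<^bsub>V\<^esub> x)) \<oplus>\<^bsub>?Q\<^esub> X = \<zero>\<^bsub>?Q\<^esub>"
      unfolding ze x(2) ad[OF V.M.a_inv_closed[OF x(1)] x(1)] V.M.l_neg[OF x(1)] ..
    then show "\<exists>Y\<in>carrier ?Q. Y \<oplus>\<^bsub>?Q\<^esub> X = \<zero>\<^bsub>?Q\<^esub>"
      using in_Q[OF V.M.a_inv_closed[OF x(1)]] by blast
  qed
  then have "Module.module K ?Q"
  proof (intro moduleI V.R.cring_axioms)
    fix a X assume a: "a \<in> carrier K" and "X \<in> carrier ?Q"
    then obtain x where x: "x \<in> carrier V" "X = N +>\<^bsub>V\<^esub> x" using rep by meson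
    show "a \<odot>\<^bsub>?Q\<^esub> X \<in> carrier ?Q"
      unfolding x(2) sm[OF a x(1)] by (intro in_Q V.smult_closed a x)
    fix b assume b: "b \<in> carrier K"
    show "(a \<oplus>\<^bsub>K\<^esub> b) \<odot>\<^bsub>?Q\<^esub> X = a \<odot>\<^bsub>?Q\<^esub> X \<oplus>\<^bsub>?Q\<^esub> b \<odot>\<^bsub>?Q\<^esub> X"
      unfolding x(2) sm[OF a x(1)] sm[OF b x(1)] sm[OF V.R.a_closed[OF a b] x(1)]
        ad[OF V.smult_closed[OF a x(1)] V.smult_closed[OF b x(1)]] V.smult_l_distr[OF a b x(1)] ..
    show "(a \<otimes>\<^bsub>K\<^esub> b) \<odot>\<^bsub>?Q\<^esub> X = a \<odot>\<^bsub>?Q\<^esub> (b \<odot>\<^bsub>?Q\<^esub> X)"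
      unfolding x(2) sm[OF b x(1)] sm[OF V.R.m_closed[OF a b] x(1)]
        sm[OF a V.smult_closed[OF b x(1)]] V.smult_assoc1[OF a b x(1)] ..
  next
    fix a X Y assume a: "a \<in> carrier K" and "X \<in> carrier ?Q" "Y \<in> carrier ?Q"
    then obtain x y where xy: "x \<in> carrier V" "y \<in> carrier V"
      "X = N +>\<^bsub>V\<^esub> x" "Y = N +>\<^bsub>V\<^esub> y" using rep by meson
    show "a \<odot>\<^bsub>?Q\<^esub> (X \<oplus>\<^bsub>?Q\<^esub> Y) = a \<odot>\<^bsub>?Q\<^esub> X \<oplus>\<^bsub>?Q\<^esub> a \<odot>\<^bsub>?Q\<^esub> Y"
      unfolding xy(3,4) ad[OF xy(1,2)] sm[OF a V.M.a_closed[OF xy(1,2)]] sm[OF a xy(1)]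
        sm[OF a xy(2)] ad[OF V.smult_closed[OF a xy(1)] V.smult_closed[OF a xy(2)]]
        V.smult_r_distr[OF a xy(1,2)] ..
  next
    fix X assume "X \<in> carrier ?Q"
    then obtain x where x: "x \<in> carrier V" "X = N +>\<^bsub>V\<^esub> x" using rep by meson
    show "\<one>\<^bsub>K\<^esub> \<odot>\<^bsub>?Q\<^esub> X = X"
      unfolding x(2) sm[OF V.R.one_closed x(1)] V.smult_one[OF x(1)] ..
  qed
  then show ?thesis
    by (intro vectorspace.intro V.field_axioms)
qed

context associative_algebra
begin

lemma vectorspace_algebra_module: "vectorspace (class_ring :: 'f ring) (algebra_module scale)"
proof (intro vectorspace.intro class_field moduleI abelian_groupI)
  show "\<exists>y\<in>carrier (algebra_module scale). y \<oplus>\<^bsub>algebra_module scale\<^esub> x = \<zero>\<^bsub>algebra_module scale\<^esub>"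
    for x by (auto simp: algebra_module_def intro: exI[of _ "- x"])
qed (auto simp: algebra_module_def algebra_simps scale_left_distrib scale_right_distrib
       intro: class_cring.is_cring)

lemma derivation_iff:
  "derivation d \<longleftrightarrow> (\<forall>x y. d (x + y) = d x + d y) \<and> (\<forall>c x. d (c *s x) = c *s d x) \<and>
     (\<forall>x y. d (x * y) = d x * y + x * d y)"
  unfolding derivation_def by (auto simp: Vector_Spaces.linear_iff vector_space_axioms)

lemma vectorspace_Der: "vectorspace (class_ring :: 'f ring) (Der scale)"
proof (intro vectorspace.intro class_field moduleI abelian_groupI)
  show "\<exists>e\<in>carrier (Der scale). e \<oplus>\<^bsub>Der scale\<^esub> d = \<zero>\<^bsub>Der scale\<^esub>" if "d \<in> carrier (Der scale)" for d
    by (rule bexI[of _ "\<lambda>x. - d x"])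
      (use that in \<open>auto simp: Der_def derivation_iff algebra_simps\<close>)
qed (auto simp: Der_def derivation_iff algebra_simps scale_left_distrib scale_right_distrib
       scale_mult_left scale_mult_right intro: class_cring.is_cring)

lemma submodule_Inder: "submodule (class_ring :: 'f ring) Inder (Der scale)"
proof (rule submodule.intro)
  show "Module.module (class_ring :: 'f ring) (Der scale)"
    using vectorspace_Der by (simp add: vectorspace_def)
  show "Inder \<subseteq> carrier (Der scale)"
    by (auto simp: Inder_def inner_derivation_def Der_def derivation_iff algebra_simps
        scale_mult_left scale_mult_right)
  show "\<zero>\<^bsub>Der scale\<^esub> \<in> Inder"
    by (auto simp: Inder_def inner_derivation_def Der_def intro!: image_eqI[of _ _ 0])
  show "d \<oplus>\<^bsub>Der scale\<^esub> e \<in> Inder" if de: "d \<in> Inder" "e \<in> Inder" for d e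
  proof -
    obtain a b where "d = inner_derivation a" "e = inner_derivation b"
      using de unfolding Inder_def by blast
    then have "d \<oplus>\<^bsub>Der scale\<^esub> e = inner_derivation (a + b)"
      by (auto simp: Der_def inner_derivation_def algebra_simps)
    then show ?thesis by (auto simp: Inder_def)
  qed
  show "c \<odot>\<^bsub>Der scale\<^esub> d \<in> Inder" if d: "d \<in> Inder" for c d
  proof -
    obtain a where "d = inner_derivation a"
      using d unfolding Inder_def by blast
    then have "c \<odot>\<^bsub>Der scale\<^esub> d = inner_derivation (c *s a)"
      by (auto simp: Der_def inner_derivation_def scale_mult_left scale_mult_right
          scale_right_diff_distrib)
    then show ?thesis by (auto simp: Inder_def)
  qed
qed

lemma vectorspace_Outder: "vectorspace (class_ring :: 'f ring) (Outder scale)"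
  unfolding Outder_def by (intro quotient_module_vectorspace vectorspace_Der submodule_Inder)

end

end

theory Submission
  imports Defs "HOL-Algebra.Free_Abelian_Groups"
begin

text \<open>The upper bound is a count: derivations are determined on a countable basis, so there are at most
  \<open>|F|\<close> to the power \<open>\<aleph>\<^sub>0\<close> of them. It remains to exhibit that many derivations that are linearly
  independent modulo the inner ones. This is needed even though the count is exact, because for a large
  field cardinality alone does not bound a dimension from below.

  The structural fact is \<open>commutant_finite_noncommutative\<close>: in an infinite-dimensional locally
  matrix algebra the commutant of a finite set is never commutative. In a chain of matrix algebras, a
  subalgebra of size \<open>n\<close> has a commutative commutant in one of size \<open>m\<close> only if \<open>m\<close> is at most \<open>n + 1\<close>. The
  proof works with idempotents and corners and treats algebras with and without unit alike.

  Iterating it along a basis gives noncommuting pairs \<open>x i\<close>, \<open>z i\<close>, where each pair commutes with all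
  other pairs and every element of the algebra commutes with almost all pairs. For any sequence of
  scalars \<open>a\<close> the sum of the \<open>a i\<close> multiples of \<open>ad (x i)\<close> is therefore a well-defined derivation.
  Evaluation at the \<open>z i\<close> shows that it can be inner only if \<open>a\<close> has finite support
  (\<open>finite_support_if_inner\<close>). Sequences modulo finitely supported sequences thus embed linearly into the
  outer derivations.

  An independent family of \<open>|F|\<close> to the power \<open>\<aleph>\<^sub>0\<close> sequences comes from Dedekind's theorem on characters
  (\<open>word_characters_independent\<close>): the free monoid on countably many letters is countable, and it has one
  character for every map from the letters to the field. Repeating each word infinitely often keeps the
  family independent modulo finite support. That an independent family of this size forces the
  dimensions is \<open>dimension_quotient_eq_of_family\<close>.\<close>

section \<open>Bases of arbitrary cardinality\<close>

lemma (in vectorspace) basis_exists: "\<exists>B. basis B"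
proof -
  let ?I = "{B. B \<subseteq> carrier V \<and> lin_indpt B}"
  have "\<exists>M\<in>?I. \<forall>B\<in>?I. M \<subseteq> B \<longrightarrow> B = M"
  proof (rule subset_Zorn)
    fix C assume C: "subset.chain ?I C"
    show "\<exists>U\<in>?I. \<forall>B\<in>C. B \<subseteq> U"
    proof (cases "C = {}")
      case True
      have "{} \<in> ?I" by (auto simp: lin_dep_def)
      with True show ?thesis by blast
    next
      case False
      have "lin_indpt (\<Union>C)"
      proof
        assume "lin_dep (\<Union>C)"
        then obtain A a v where A: "finite A" "A \<subseteq> \<Union>C" "a \<in> A \<rightarrow> carrier K"
            "lincomb a A = \<zero>\<^bsub>V\<^esub>" "v \<in> A" "a v \<noteq> \<zero>\<^bsub>K\<^esub>"
          unfolding lin_dep_def by blast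
        obtain B where "B \<in> C" "A \<subseteq> B"
          using finite_subset_Union_chain[OF A(1,2) False C] by blast
        with A have "lin_dep B" unfolding lin_dep_def by blast
        with \<open>B \<in> C\<close> C show False unfolding subset_chain_def by blast
      qed
      moreover have "\<Union>C \<subseteq> carrier V" using C unfolding subset_chain_def by blast
      ultimately show ?thesis by blast
    qed
  qed
  then obtain M where "M \<in> ?I" and "\<forall>B\<in>?I. M \<subseteq> B \<longrightarrow> B = M" by (rule bexE)
  then have "maximal M (\<lambda>S. S \<subseteq> carrier V \<and> lin_indpt S)"
    unfolding maximal_def by simp
  then show ?thesis using max_li_is_basis by blast
qed

text \<open>Each element of \<open>X\<close> lies in the span of a finite subset of \<open>B\<close>. By the replacement theorem such a
  span contains only finitely many elements of \<open>X\<close>, and an infinite \<open>B\<close> has just \<open>|B|\<close> finite subsets.\<close>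

lemma (in vectorspace) lin_indpt_ordLeq_gen_set:
  assumes X: "X \<subseteq> carrier V" "lin_indpt X" "infinite X"
    and B: "B \<subseteq> carrier V" "gen_set B"
  shows "|X| \<le>o |B|"
proof -
  have "infinite B"
    using fin_dim_li_fin[of X] X B unfolding fin_dim_def by blast
  have fin: "finite (X \<inter> span F)" if F: "F \<in> Fpow B" for F
  proof (rule ccontr)
    assume "infinite (X \<inter> span F)"
    then obtain Y where Y: "finite Y" "card Y = Suc (card F)" "Y \<subseteq> X \<inter> span F"
      by (metis infinite_arbitrarily_large)
    have "lin_indpt Y" using subset_li_is_li[of X Y] X Y by blast
    then obtain C :: "'c set" where "int (card C) \<le> int (card F) - int (card Y)"
      using replacement[of Y F] Y F B unfolding Fpow_def by blast
    with Y(2) show False by simp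
  qed
  have "X \<subseteq> (\<Union>F\<in>Fpow B. X \<inter> span F)"
  proof
    fix x assume "x \<in> X"
    then have "x \<in> span B" using X B by blast
    then obtain F a where "finite F" "F \<subseteq> B" "a \<in> F \<rightarrow> carrier K" "x = lincomb a F"
      unfolding span_def by blast
    then have "x \<in> span F" "F \<in> Fpow B" unfolding span_def Fpow_def by blast+
    with \<open>x \<in> X\<close> show "x \<in> (\<Union>F\<in>Fpow B. X \<inter> span F)" by blast
  qed
  then have "|X| \<le>o |\<Union>F\<in>Fpow B. X \<inter> span F|" by (rule card_of_mono1)
  also have "|\<Union>F\<in>Fpow B. X \<inter> span F| \<le>o |B|"
    using \<open>infinite B\<close> fin
    by (intro card_of_UNION_ordLeq_infinite)
      (auto intro: ordIso_imp_ordLeq finite_ordLess_infinite2 ordLess_imp_ordLeq)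
  finally show ?thesis .
qed

text \<open>Independence of an indexed family also makes the indexing injective, so the family has as many
  members as indices.\<close>

lemma (in vectorspace) lin_indpt_family:
  assumes v: "v ` I \<subseteq> carrier V"
    and indep: "\<And>S c. finite S \<Longrightarrow> S \<subseteq> I \<Longrightarrow> c \<in> S \<rightarrow> carrier K \<Longrightarrow>
      (\<Oplus>\<^bsub>V\<^esub>i\<in>S. c i \<odot>\<^bsub>V\<^esub> v i) = \<zero>\<^bsub>V\<^esub> \<Longrightarrow> \<forall>i\<in>S. c i = \<zero>\<^bsub>K\<^esub>"
  shows "inj_on v I" "lin_indpt (v ` I)"
proof -
  show inj: "inj_on v I"
  proof (rule inj_onI, rule ccontr)
    fix i j assume ij: "i \<in> I" "j \<in> I" "v i = v j" "i \<noteq> j"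
    let ?c = "\<lambda>k. if k = i then \<one>\<^bsub>K\<^esub> else \<ominus>\<^bsub>K\<^esub> \<one>\<^bsub>K\<^esub>"
    have vj: "v j \<in> carrier V" using v ij by blast
    \<comment> \<open>a repeated vector gives the relation with coefficients 1 and -1\<close>
    have "(\<Oplus>\<^bsub>V\<^esub>k\<in>{i, j}. ?c k \<odot>\<^bsub>V\<^esub> v k) = \<zero>\<^bsub>V\<^esub>"
    proof -
      have "(\<Oplus>\<^bsub>V\<^esub>k\<in>{i, j}. ?c k \<odot>\<^bsub>V\<^esub> v k) = \<one>\<^bsub>K\<^esub> \<odot>\<^bsub>V\<^esub> v j \<oplus>\<^bsub>V\<^esub> (\<ominus>\<^bsub>K\<^esub> \<one>\<^bsub>K\<^esub>) \<odot>\<^bsub>V\<^esub> v j"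
        using ij vj by (subst M.finsum_insert) (auto simp: Pi_def)
      also have "\<dots> = v j \<oplus>\<^bsub>V\<^esub> \<ominus>\<^bsub>V\<^esub> v j"
        using vj by (simp only: smult_minus_1 smult_one)
      also have "\<dots> = \<zero>\<^bsub>V\<^esub>" using vj by (rule M.r_neg)
      finally show ?thesis .
    qed
    then have "\<forall>k\<in>{i, j}. ?c k = \<zero>\<^bsub>K\<^esub>"
    proof (rule indep[rotated 3])
      show "?c \<in> {i, j} \<rightarrow> carrier K" by (simp add: Pi_def)
    qed (use ij in simp_all)
    then show False by simp
  qed
  show "lin_indpt (v ` I)"
  proof
    assume "lin_dep (v ` I)"
    then obtain A a w where A: "finite A" "A \<subseteq> v ` I" "a \<in> A \<rightarrow> carrier K"
        "lincomb a A = \<zero>\<^bsub>V\<^esub>" "w \<in> A" "a w \<noteq> \<zero>\<^bsub>K\<^esub>"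
      unfolding lin_dep_def by blast
    obtain S where S: "S \<subseteq> I" "finite S" "A = v ` S"
      using A finite_subset_image by metis
    have injS: "inj_on v S" using inj S(1) by (rule inj_on_subset)
    have "(\<Oplus>\<^bsub>V\<^esub>i\<in>S. a (v i) \<odot>\<^bsub>V\<^esub> v i) = (\<Oplus>\<^bsub>V\<^esub>x\<in>v ` S. a x \<odot>\<^bsub>V\<^esub> x)"
    proof (intro M.finsum_reindex[symmetric] injS Pi_I smult_closed)
      fix x assume "x \<in> v ` S"
      then show "a x \<in> carrier K" "x \<in> carrier V" using A(3) S v by auto
    qed
    also have "\<dots> = \<zero>\<^bsub>V\<^esub>" using A(4) S(3) by (simp add: lincomb_def)
    finally have "\<forall>i\<in>S. a (v i) = \<zero>\<^bsub>K\<^esub>"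
      using A(3) S by (intro indep) auto
    then show False using A S by auto
  qed
qed

text \<open>The cardinality of a space does not determine its dimension when there are as many scalars as
  vectors. An independent family as large as the space does: it bounds every basis from below, and a
  basis is a subset of the space.\<close>

lemma dimension_eq_of_family:
  assumes "vectorspace K V"
    and inf: "infinite I" and v: "v ` I \<subseteq> carrier V" and small: "|carrier V| \<le>o |I|"
    and indep: "\<And>S c. finite S \<Longrightarrow> S \<subseteq> I \<Longrightarrow> c \<in> S \<rightarrow> carrier K \<Longrightarrow>
      (\<Oplus>\<^bsub>V\<^esub>i\<in>S. c i \<odot>\<^bsub>V\<^esub> v i) = \<zero>\<^bsub>V\<^esub> \<Longrightarrow> \<forall>i\<in>S. c i = \<zero>\<^bsub>K\<^esub>"
  shows "dimension K V =o |I|"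
proof -
  interpret vectorspace K V by fact
  have fam: "inj_on v I" "lin_indpt (v ` I)" by (rule lin_indpt_family[OF v indep]; assumption)+
  have I: "|I| =o |v ` I|"
    using fam(1) card_of_ordIso unfolding bij_betw_def by blast
  define B where "B = (SOME B. basis B)"
  have "basis B" unfolding B_def using basis_exists by (rule someI_ex)
  then have B: "gen_set B" "B \<subseteq> carrier V" by (auto simp: basis_def)
  have "infinite (v ` I)" using inf finite_imageD fam(1) by blast
  then have "|v ` I| \<le>o |B|" using lin_indpt_ordLeq_gen_set v fam(2) B by blast
  then have "|I| \<le>o |B|" using I ordIso_ordLeq_trans by blast
  moreover have "|B| \<le>o |I|" using card_of_mono1[OF B(2)] small ordLeq_transitive by blast
  ultimately have "|B| =o |I|" by (simp only: ordIso_iff_ordLeq)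
  then show ?thesis unfolding dimension_def B_def .
qed

lemma quotient_module_hom:
  assumes V: "vectorspace K V" and N: "submodule K N V"
  shows "mod_hom K V (quotient_module V N) (\<lambda>x. N +>\<^bsub>V\<^esub> x)"
    and "\<And>x. x \<in> carrier V \<Longrightarrow> N +>\<^bsub>V\<^esub> x = \<zero>\<^bsub>quotient_module V N\<^esub> \<Longrightarrow> x \<in> N"
proof -
  interpret V: vectorspace K V by (rule V)
  interpret N: submodule K N V by (rule N)
  interpret Q: vectorspace K "quotient_module V N"
    using V N by (rule quotient_module_vectorspace)
  have "additive_subgroup N V"
  proof (rule additive_subgroup.intro, rule V.M.add.subgroupI)
    show "\<ominus>\<^bsub>V\<^esub> x \<in> N" if "x \<in> N" for x
      using N.smult_closed[OF _ that, of "\<ominus>\<^bsub>K\<^esub> \<one>\<^bsub>K\<^esub>"] N.subset that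
      by (metis V.R.add.inv_closed V.R.one_closed V.smult_minus_1 subsetD)
    show "N \<noteq> {}" using N.zero_closed by blast
  qed (use N.subset N.m_closed in auto)
  then interpret S: abelian_subgroup N V
    by (rule abelian_subgroupI3) (rule V.M.abelian_group_axioms)
  show "x \<in> N" if "x \<in> carrier V" "N +>\<^bsub>V\<^esub> x = \<zero>\<^bsub>quotient_module V N\<^esub>" for x
    using S.a_rcos_self[OF that(1)] that(2) by (simp add: quotient_module_def)
  have sm: "(\<Union>y\<in>N +>\<^bsub>V\<^esub> x. N +>\<^bsub>V\<^esub> (c \<odot>\<^bsub>V\<^esub> y)) = N +>\<^bsub>V\<^esub> (c \<odot>\<^bsub>V\<^esub> x)"
    if c: "c \<in> carrier K" and x: "x \<in> carrier V" for c x
  proof -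
    have "N +>\<^bsub>V\<^esub> (c \<odot>\<^bsub>V\<^esub> y) = N +>\<^bsub>V\<^esub> (c \<odot>\<^bsub>V\<^esub> x)" if y: "y \<in> N +>\<^bsub>V\<^esub> x" for y
    proof -
      obtain n where n: "n \<in> N" "y = n \<oplus>\<^bsub>V\<^esub> x" using y unfolding a_r_coset_def' by auto
      then have "c \<odot>\<^bsub>V\<^esub> y = c \<odot>\<^bsub>V\<^esub> n \<oplus>\<^bsub>V\<^esub> c \<odot>\<^bsub>V\<^esub> x"
        using c x N.subset V.smult_r_distr by auto
      then have "c \<odot>\<^bsub>V\<^esub> y \<in> N +>\<^bsub>V\<^esub> (c \<odot>\<^bsub>V\<^esub> x)"
        using N.smult_closed[OF c n(1)] unfolding a_r_coset_def' by auto
      from V.M.a_repr_independence[OF this V.smult_closed[OF c x] S.a_subgroup]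
      show ?thesis by (rule sym)
    qed
    then show ?thesis using S.a_rcos_self[OF x] by blast
  qed
  have "(\<lambda>x. N +>\<^bsub>V\<^esub> x) \<in> LinearCombinations.module_hom K V (quotient_module V N)"
    unfolding LinearCombinations.module_hom_def mem_Collect_eq
  proof (intro conjI ballI allI impI)
    show "(\<lambda>x. N +>\<^bsub>V\<^esub> x) \<in> carrier V \<rightarrow> carrier (quotient_module V N)"
      by (auto simp: quotient_module_def A_RCOSETS_def')
    fix x y assume xy: "x \<in> carrier V \<and> y \<in> carrier V"
    show "N +>\<^bsub>V\<^esub> (x \<oplus>\<^bsub>V\<^esub> y) = (N +>\<^bsub>V\<^esub> x) \<oplus>\<^bsub>quotient_module V N\<^esub> (N +>\<^bsub>V\<^esub> y)"
      using S.a_rcos_sum[of x y] xy by (simp only: quotient_module_def ring_record_simps)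
  next
    fix c x assume "c \<in> carrier K \<and> x \<in> carrier V"
    then show "N +>\<^bsub>V\<^esub> (c \<odot>\<^bsub>V\<^esub> x) = c \<odot>\<^bsub>quotient_module V N\<^esub> (N +>\<^bsub>V\<^esub> x)"
      using sm[of c x] by (simp only: quotient_module_def module.simps)
  qed
  then show "mod_hom K V (quotient_module V N) (\<lambda>x. N +>\<^bsub>V\<^esub> x)"
    by (intro mod_hom.intro mod_hom_axioms.intro V.module_axioms Q.module_axioms)
qed

lemma (in mod_hom) hom_finsum:
  assumes "finite S" and "g \<in> S \<rightarrow> carrier M"
  shows "f (\<Oplus>\<^bsub>M\<^esub>i\<in>S. g i) = (\<Oplus>\<^bsub>N\<^esub>i\<in>S. f (g i))"
  using assms
proof (induction S rule: finite_induct)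
  case (insert i S)
  then have g: "g \<in> S \<rightarrow> carrier M" "g i \<in> carrier M" by auto
  have "f (\<Oplus>\<^bsub>M\<^esub>i\<in>insert i S. g i) = f (g i \<oplus>\<^bsub>M\<^esub> (\<Oplus>\<^bsub>M\<^esub>i\<in>S. g i))"
    using insert.hyps g by (simp add: M.M.finsum_insert)
  also have "\<dots> = f (g i) \<oplus>\<^bsub>N\<^esub> f (\<Oplus>\<^bsub>M\<^esub>i\<in>S. g i)"
    using g by (intro f_add) (auto intro: M.M.finsum_closed)
  also have "\<dots> = (\<Oplus>\<^bsub>N\<^esub>i\<in>insert i S. f (g i))"
    using insert.hyps g insert.IH[OF g(1)] by (subst N.M.finsum_insert) auto
  finally show ?case .
qed simp

text \<open>A family independent modulo \<open>N\<close> is independent in \<open>V\<close>, since \<open>N\<close> contains zero, and its cosets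
  are independent in the quotient, where zero is the coset \<open>N\<close>. One such family thus computes both
  dimensions.\<close>

lemma dimension_quotient_eq_of_family:
  assumes V: "vectorspace K V" and N: "submodule K N V"
    and I: "infinite I" and v: "v ` I \<subseteq> carrier V" and small: "|carrier V| \<le>o |I|"
    and indep: "\<And>S c. finite S \<Longrightarrow> S \<subseteq> I \<Longrightarrow> c \<in> S \<rightarrow> carrier K \<Longrightarrow>
      (\<Oplus>\<^bsub>V\<^esub>i\<in>S. c i \<odot>\<^bsub>V\<^esub> v i) \<in> N \<Longrightarrow> \<forall>i\<in>S. c i = \<zero>\<^bsub>K\<^esub>"
  shows "dimension K V =o |I|" "dimension K (quotient_module V N) =o |I|"
proof -
  interpret V: vectorspace K V by (rule V)
  interpret Q: vectorspace K "quotient_module V N"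
    using V N by (rule quotient_module_vectorspace)
  note hom = quotient_module_hom(1)[OF V N]
  show "dimension K V =o |I|"
  proof (rule dimension_eq_of_family[OF V I v small])
    fix S c assume S: "finite S" "S \<subseteq> I" "c \<in> S \<rightarrow> carrier K"
      and "(\<Oplus>\<^bsub>V\<^esub>i\<in>S. c i \<odot>\<^bsub>V\<^esub> v i) = \<zero>\<^bsub>V\<^esub>"
    then have "(\<Oplus>\<^bsub>V\<^esub>i\<in>S. c i \<odot>\<^bsub>V\<^esub> v i) \<in> N" using submodule.zero_closed[OF N] by (simp only:)
    then show "\<forall>i\<in>S. c i = \<zero>\<^bsub>K\<^esub>" by (rule indep[OF S])
  qed
  show "dimension K (quotient_module V N) =o |I|"
  proof (rule dimension_eq_of_family[OF quotient_module_vectorspace[OF V N] I])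
    show "(\<lambda>i. N +>\<^bsub>V\<^esub> v i) ` I \<subseteq> carrier (quotient_module V N)"
      using v mod_hom.f_im[OF hom] by blast
    have "carrier (quotient_module V N) = (\<lambda>x. N +>\<^bsub>V\<^esub> x) ` carrier V"
      by (auto simp: quotient_module_def A_RCOSETS_def')
    then have "|carrier (quotient_module V N)| \<le>o |carrier V|" by (simp only: card_of_image)
    then show "|carrier (quotient_module V N)| \<le>o |I|" using small by (rule ordLeq_transitive)
    fix S c assume S: "finite S" "S \<subseteq> I" "c \<in> S \<rightarrow> carrier K"
      and z: "(\<Oplus>\<^bsub>quotient_module V N\<^esub>i\<in>S. c i \<odot>\<^bsub>quotient_module V N\<^esub> (N +>\<^bsub>V\<^esub> v i))
        = \<zero>\<^bsub>quotient_module V N\<^esub>"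
    have mem: "c i \<odot>\<^bsub>V\<^esub> v i \<in> carrier V" if "i \<in> S" for i
      using that S v by (intro V.smult_closed) auto
    have "N +>\<^bsub>V\<^esub> (\<Oplus>\<^bsub>V\<^esub>i\<in>S. c i \<odot>\<^bsub>V\<^esub> v i)
        = (\<Oplus>\<^bsub>quotient_module V N\<^esub>i\<in>S. N +>\<^bsub>V\<^esub> (c i \<odot>\<^bsub>V\<^esub> v i))"
      using S(1) mem by (intro mod_hom.hom_finsum[OF hom] Pi_I)
    also have "\<dots> = (\<Oplus>\<^bsub>quotient_module V N\<^esub>i\<in>S. c i \<odot>\<^bsub>quotient_module V N\<^esub> (N +>\<^bsub>V\<^esub> v i))"
    proof (intro Q.M.finsum_cong' refl Pi_I)
      fix i assume i: "i \<in> S"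
      then have ci: "c i \<in> carrier K" "v i \<in> carrier V" using S v by auto
      from LinearCombinations.module_hom_smult[OF mod_hom.f_hom[OF hom] this]
      show "N +>\<^bsub>V\<^esub> (c i \<odot>\<^bsub>V\<^esub> v i) = c i \<odot>\<^bsub>quotient_module V N\<^esub> (N +>\<^bsub>V\<^esub> v i)" .
      then show "c i \<odot>\<^bsub>quotient_module V N\<^esub> (N +>\<^bsub>V\<^esub> v i) \<in> carrier (quotient_module V N)"
        using mod_hom.f_im[OF hom mem[OF i]] by simp
    qed
    finally have "(\<Oplus>\<^bsub>V\<^esub>i\<in>S. c i \<odot>\<^bsub>V\<^esub> v i) \<in> N"
      using z mem by (intro quotient_module_hom(2)[OF V N] V.M.finsum_closed Pi_I) simp_all
    then show "\<forall>i\<in>S. c i = \<zero>\<^bsub>K\<^esub>" by (rule indep[OF S])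
  qed
qed

section \<open>Characters of the free monoid as sequences\<close>

text \<open>Dedekind's independence of characters for the free monoid on countably many letters: \<open>a\<close> acts on
  words by multiplying the values of its letters, and distinct \<open>a\<close> give distinct characters. There are
  \<open>|F|\<close> to the power \<open>\<aleph>\<^sub>0\<close> choices of \<open>a\<close>, but only countably many words, which is what makes these vectors
  usable as coefficient sequences.\<close>

lemma word_characters_independent:
  fixes c :: "(nat \<Rightarrow> 'f::idom) \<Rightarrow> 'f"
  assumes "finite S" and "\<And>w. (\<Sum>a\<in>S. c a * prod_list (map a w)) = 0" and "a \<in> S"
  shows "c a = 0"
  using assms
proof (induction S arbitrary: c a rule: finite_induct)
  case (insert b S)
  have S: "c a = 0" if a: "a \<in> S" for a
  proof -
    have "a \<noteq> b" using a insert.hyps by blast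
    then obtain k where k: "a k \<noteq> b k" by blast
    \<comment> \<open>subtracting b k times the relation at w from the relation at k # w removes the term of b\<close>
    have "(\<Sum>a\<in>S. (c a * (a k - b k)) * prod_list (map a w)) = 0" for w
    proof -
      have "(\<Sum>a\<in>insert b S. (c a * (a k - b k)) * prod_list (map a w))
          = (\<Sum>a\<in>insert b S. c a * prod_list (map a (k # w)))
            - b k * (\<Sum>a\<in>insert b S. c a * prod_list (map a w))"
        by (simp only: sum_distrib_left sum_subtractf[symmetric])
           (intro sum.cong refl, simp add: algebra_simps)
      also have "\<dots> = 0" by (simp only: insert.prems(1)) simp
      finally show ?thesis using insert.hyps by simp
    qed
    from insert.IH[OF this a] k show ?thesis by simp
  qed
  have "c b = 0"
    using insert.prems(1)[of "[]"] insert.hyps S by simp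
  then show ?case using S insert.prems(2) by blast
qed simp


text \<open>The character values listed along an enumeration that meets every word infinitely often. A relation
  that holds only from some position on then still holds at every word.\<close>

definition word_sequence :: "(nat \<Rightarrow> 'f::monoid_mult) \<Rightarrow> nat \<Rightarrow> 'f" where
  "word_sequence a i = prod_list (map a (snd (from_nat i :: nat \<times> nat list)))"

lemma word_sequences_independent:
  fixes c :: "(nat \<Rightarrow> 'f::idom) \<Rightarrow> 'f"
  assumes "finite S" and ev: "\<And>i. i \<ge> k \<Longrightarrow> (\<Sum>a\<in>S. c a * word_sequence a i) = 0" and "a \<in> S"
  shows "c a = 0"
proof (rule word_characters_independent[OF assms(1) _ assms(3)])
  fix w :: "nat list"
  have "inj (\<lambda>m. to_nat (m :: nat, w))" by (auto intro: injI)
  then have "infinite (range (\<lambda>m. to_nat (m :: nat, w)))" by (rule range_inj_infinite)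
  then obtain m :: nat where "to_nat (m, w) \<ge> k" unfolding infinite_nat_iff_unbounded_le by blast
  from ev[OF this] show "(\<Sum>a\<in>S. c a * prod_list (map a w)) = 0"
    by (simp add: word_sequence_def)
qed

section \<open>Matrix units and corners\<close>

text \<open>A matrix subalgebra seen from inside the algebra: \<open>E\<close> are its matrix units and \<open>coef x j k\<close> is the
  entry of \<open>x\<close> at \<open>(j, k)\<close>. The sandwich law reads off entries by multiplication alone; together with
  the fact that a nonzero element has a nonzero entry, it replaces all later matrix computations.\<close>

locale matrix_unit_system = associative_algebra scale
  for scale :: "'f::field \<Rightarrow> 'a::ring \<Rightarrow> 'a" (infixr \<open>*s\<close> 75) +
  fixes B :: "'a set" and n :: nat and E :: "nat \<Rightarrow> nat \<Rightarrow> 'a"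
    and coef :: "'a \<Rightarrow> nat \<Rightarrow> nat \<Rightarrow> 'f"
  assumes subalgebra: "subalgebra B"
    and unit_mem: "i < n \<Longrightarrow> j < n \<Longrightarrow> E i j \<in> B"
    and unit_nonzero: "i < n \<Longrightarrow> j < n \<Longrightarrow> E i j \<noteq> 0"
    and unit_mult: "i < n \<Longrightarrow> j < n \<Longrightarrow> k < n \<Longrightarrow> l < n \<Longrightarrow>
      E i j * E k l = (if j = k then E i l else 0)"
    and unit_sandwich: "i < n \<Longrightarrow> j < n \<Longrightarrow> k < n \<Longrightarrow> l < n \<Longrightarrow> x \<in> B \<Longrightarrow>
      E i j * x * E k l = coef x j k *s E i l"
    and nonzero_coef: "x \<in> B \<Longrightarrow> x \<noteq> 0 \<Longrightarrow> \<exists>j<n. \<exists>k<n. coef x j k \<noteq> 0"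
begin

lemma closed:
  shows "x \<in> B \<Longrightarrow> y \<in> B \<Longrightarrow> x + y \<in> B" "x \<in> B \<Longrightarrow> y \<in> B \<Longrightarrow> x - y \<in> B"
    and "x \<in> B \<Longrightarrow> y \<in> B \<Longrightarrow> x * y \<in> B" "x \<in> B \<Longrightarrow> c *s x \<in> B"
    and "(\<And>i. i \<in> I \<Longrightarrow> f i \<in> B) \<Longrightarrow> sum f I \<in> B"
  using subalgebra
  by (auto simp: subalgebra_def subspace_add subspace_diff subspace_scale intro: subspace_sum)

definition unity :: 'a where "unity = (\<Sum>i<n. E i i)"

lemma unity_mem: "unity \<in> B"
  unfolding unity_def by (intro closed unit_mem) auto

lemma unit_eqI:
  assumes x: "x \<in> B" "y \<in> B"
    and eq: "\<And>j k. j < n \<Longrightarrow> k < n \<Longrightarrow> E j j * x * E k k = E j j * y * E k k"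
  shows "x = y"
proof (rule ccontr)
  assume "x \<noteq> y"
  then obtain j k where jk: "j < n" "k < n" "coef (x - y) j k \<noteq> 0"
    using nonzero_coef[of "x - y"] x closed by auto
  have "coef (x - y) j k *s E j k = E j j * (x - y) * E k k"
    using jk x closed by (simp add: unit_sandwich)
  also have "\<dots> = 0" using eq[OF jk(1,2)] by (simp add: algebra_simps)
  finally show False using jk unit_nonzero by simp
qed

lemma unit_unity:
  assumes "i < n" "j < n"
  shows "E i j * unity = E i j" "unity * E i j = E i j"
proof -
  have "E i j * unity = (\<Sum>k<n. if k = j then E i j else 0)"
    unfolding unity_def sum_distrib_left by (rule sum.cong) (use assms in \<open>auto simp: unit_mult\<close>)
  then show "E i j * unity = E i j" using assms by simp
  have "unity * E i j = (\<Sum>k<n. if k = i then E i j else 0)"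
    unfolding unity_def sum_distrib_right by (rule sum.cong) (use assms in \<open>auto simp: unit_mult\<close>)
  then show "unity * E i j = E i j" using assms by simp
qed

lemma unity_neutral: assumes "x \<in> B" shows "unity * x = x" "x * unity = x"
proof -
  show "unity * x = x"
    by (rule unit_eqI) (use assms closed unity_mem in \<open>auto simp: unit_unity simp flip: mult.assoc\<close>)
  show "x * unity = x"
    by (rule unit_eqI) (use assms closed unity_mem in \<open>auto simp: unit_unity mult.assoc\<close>)
qed

text \<open>For matrix units \<open>q\<close> the exchange law compares every entry of \<open>x\<close> times a fixed nonzero entry of \<open>y\<close>
  with the same entry of \<open>y\<close> times a fixed entry of \<open>x\<close>.\<close>

lemma proportional_if_exchangeable:
  assumes x: "x \<in> B" and y: "y \<in> B" "y \<noteq> 0"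
    and exch: "\<And>q. q \<in> B \<Longrightarrow> x * q * y = y * q * x"
  shows "\<exists>c. x = c *s y"
proof -
  obtain k l where kl: "k < n" "l < n" "coef y k l \<noteq> 0" using nonzero_coef y by blast
  have eq: "coef y k l *s x = coef x k l *s y"
  proof (rule unit_eqI)
    fix j a assume ja: "j < n" "a < n"
    have "x * E a k * y * E l a = y * E a k * x * E l a"
      using exch[OF unit_mem] ja kl by simp
    then have "x * (E a k * y * E l a) = y * (E a k * x * E l a)"
      by (simp add: mult.assoc)
    then have "x * (coef y k l *s E a a) = y * (coef x k l *s E a a)"
      using ja kl x y by (simp add: unit_sandwich)
    then have "E j j * (x * (coef y k l *s E a a)) = E j j * (y * (coef x k l *s E a a))"
      by simp
    then show "E j j * (coef y k l *s x) * E a a = E j j * (coef x k l *s y) * E a a"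
      by (simp add: scale_mult_left scale_mult_right mult.assoc)
  qed (use x y closed in auto)
  have "x = inverse (coef y k l) *s coef y k l *s x" using kl by simp
  then show ?thesis unfolding eq by (metis scale_scale)
qed

text \<open>A matrix unit placed between a nonzero entry of \<open>x\<close> and a nonzero entry of \<open>y\<close> carries the product of
  the two entries into \<open>x * q * y\<close>.\<close>

lemma prime:
  assumes x: "x \<in> B" "x \<noteq> 0" and y: "y \<in> B" "y \<noteq> 0"
  shows "\<exists>q\<in>B. x * q * y \<noteq> 0"
proof -
  obtain a b where ab: "a < n" "b < n" "coef x a b \<noteq> 0" using nonzero_coef x by blast
  obtain c d where cd: "c < n" "d < n" "coef y c d \<noteq> 0" using nonzero_coef y by blast
  have "E a a * (x * E b c * y) * E d d = (E a a * x * E b b) * (E b c * y * E d d)"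
    using ab cd by (simp add: mult.assoc unit_mult flip: mult.assoc[of "E b b"])
  also have "\<dots> = coef x a b *s coef y c d *s E a d"
    using ab cd x y by (simp add: unit_sandwich unit_mult scale_mult_left scale_mult_right)
  also have "\<dots> \<noteq> 0" using ab cd unit_nonzero by simp
  finally have "x * E b c * y \<noteq> 0" by auto
  then show ?thesis using unit_mem ab cd by blast
qed

text \<open>For an idempotent \<open>f\<close> the hypothesis says that the corner \<open>f * B * f\<close> is commutative, and it then
  makes \<open>f * s * f\<close> and \<open>f\<close> exchangeable: in a matrix algebra a commutative corner is at most one-dimensional.\<close>

lemma corner_scalar:
  assumes f: "f \<in> B"
    and comm: "\<And>s t. s \<in> B \<Longrightarrow> t \<in> B \<Longrightarrow> (f * s * f) * (t * f) = (f * t * f) * (s * f)"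
    and s: "s \<in> B"
  shows "\<exists>c. f * s * f = c *s f"
proof (cases "f = 0")
  case False
  show ?thesis
  proof (rule proportional_if_exchangeable)
    fix q assume "q \<in> B"
    then show "(f * s * f) * q * f = f * q * (f * s * f)"
      using comm[OF s, of q] by (simp add: mult.assoc)
  qed (use f s False closed in auto)
qed simp

text \<open>The rectangular corner between two elements of rank at most one has dimension at most one.
  If \<open>u\<close> is a nonzero element of it, primeness supplies \<open>t\<close> with \<open>u * t * f \<noteq> 0\<close>; for any other element
  \<open>w\<close> of this corner, \<open>u * t * w\<close> is a nonzero multiple of \<open>w\<close> by the scalars of \<open>f\<close> and a multiple of
  \<open>u\<close> by the scalars of \<open>f'\<close>.\<close>

lemma corner_rank_one:
  assumes f: "f \<in> B" and f': "f' \<in> B"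
    and scalar: "\<And>s. s \<in> B \<Longrightarrow> \<exists>c. f * s * f = c *s f"
    and scalar': "\<And>s. s \<in> B \<Longrightarrow> \<exists>c. f' * s * f' = c *s f'"
  shows "\<exists>u. \<forall>z\<in>B. \<exists>c. f * z * f' = c *s u"
proof (cases "\<exists>z\<in>B. f * z * f' \<noteq> 0")
  case True
  then obtain z0 where z0: "z0 \<in> B" "f * z0 * f' \<noteq> 0" by blast
  then have "f \<noteq> 0" by auto
  then obtain t where t: "t \<in> B" "(f * z0 * f') * t * f \<noteq> 0"
    using prime[of "f * z0 * f'" f] z0 f f' closed by auto
  obtain \<alpha> where \<alpha>: "f * (z0 * f' * t) * f = \<alpha> *s f"
    using scalar[of "z0 * f' * t"] z0 t f' closed by auto
  have "\<alpha> \<noteq> 0" using t(2) \<alpha> by (auto simp: mult.assoc)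
  have "\<exists>c. f * z * f' = c *s (f * z0 * f')" if z: "z \<in> B" for z
  proof -
    obtain \<beta> where \<beta>: "f' * (t * f * z) * f' = \<beta> *s f'"
      using scalar'[of "t * f * z"] z t f closed by auto
    have "\<alpha> *s (f * z * f') = (\<alpha> *s f) * z * f'" by (simp add: scale_mult_left)
    also have "\<dots> = f * z0 * (f' * (t * f * z) * f')" by (simp only: \<alpha>[symmetric] mult.assoc)
    also have "\<dots> = \<beta> *s (f * z0 * f')" by (simp only: \<beta> scale_mult_right)
    finally have "inverse \<alpha> *s \<alpha> *s (f * z * f') = inverse \<alpha> *s \<beta> *s (f * z0 * f')" by simp
    then show ?thesis using \<open>\<alpha> \<noteq> 0\<close> by auto
  qed
  then show ?thesis by blast
qed (auto intro: exI[of _ 0])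

end

lemma (in associative_algebra) matrix_unit_system_of_matrix_iso:
  assumes B: "subalgebra B" and iso: "matrix_iso n B \<phi>"
  obtains E coef where "matrix_unit_system scale B n E coef"
proof -
  have bij: "bij_betw \<phi> B (carrier_mat n n)"
    and mult: "\<And>x y. x \<in> B \<Longrightarrow> y \<in> B \<Longrightarrow> \<phi> (x * y) = \<phi> x * \<phi> y"
    and smult: "\<And>c x. x \<in> B \<Longrightarrow> \<phi> (c *s x) = c \<cdot>\<^sub>m \<phi> x"
    using iso unfolding matrix_iso_def by blast+
  have inj: "inj_on \<phi> B" using bij by (rule bij_betw_imp_inj_on)
  have car: "\<phi> x \<in> carrier_mat n n" if "x \<in> B" for x
    using bij that by (rule bij_betw_apply)
  have closed: "x * y \<in> B" "c *s x \<in> B" if "x \<in> B" "y \<in> B" for x y c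
    using B that by (auto simp: subalgebra_def subspace_scale)
  have zero: "0 \<in> B" using B by (simp add: subalgebra_def subspace_0)
  have "\<phi> 0 = 0 \<cdot>\<^sub>m \<phi> 0" using smult[OF zero, of 0] by simp
  also have "\<dots> = 0\<^sub>m n n" using car[OF zero] by (intro eq_matI) auto
  finally have \<phi>0: "\<phi> 0 = 0\<^sub>m n n" .
  \<comment> \<open>the elementary matrices, whose preimages under the isomorphism are the matrix units\<close>
  define U where "U i j = (mat n n (\<lambda>(a, b). if a = i \<and> b = j then 1 else 0) :: 'f mat)" for i j
  define E where "E i j = inv_into B \<phi> (U i j)" for i j
  have U: "U i j \<in> carrier_mat n n" for i j by (simp add: U_def)
  have E: "E i j \<in> B" "\<phi> (E i j) = U i j" for i j
    using bij_betw_imp_surj_on[OF bij] U[of i j] unfolding E_def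
    by (auto intro: inv_into_into f_inv_into_f)
  have UM: "U i j * M = mat n n (\<lambda>(a, b). if a = i then M $$ (j, b) else 0)"
    if "M \<in> carrier_mat n n" "i < n" "j < n" for i j M
    using that by (intro eq_matI)
      (auto simp: U_def scalar_prod_def if_distrib[of "\<lambda>x. x * _"] cong: if_cong)
  have MU: "U i j * M * U k l = M $$ (j, k) \<cdot>\<^sub>m U i l"
    if "M \<in> carrier_mat n n" "i < n" "j < n" "k < n" "l < n" for i j k l M
    unfolding UM[OF that(1-3)]
    using that by (intro eq_matI)
      (auto simp: U_def scalar_prod_def if_distrib[of "\<lambda>x. _ * x"] cong: if_cong)
  have UU: "U i j * U k l = (if j = k then U i l else 0\<^sub>m n n)"
    if "i < n" "j < n" "k < n" "l < n" for i j k l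
    unfolding UM[OF U that(1,2)] using that by (intro eq_matI) (auto simp: U_def)
  have "matrix_unit_system scale B n E (\<lambda>x i j. \<phi> x $$ (i, j))"
  proof unfold_locales
    show "subalgebra B" by fact
    show "E i j \<in> B" for i j by (rule E)
    show "E i j \<noteq> 0" if "i < n" "j < n" for i j
    proof
      assume "E i j = 0"
      then have "U i j = 0\<^sub>m n n" using E(2)[of i j] \<phi>0 by simp
      then have "U i j $$ (i, j) = 0" using that by simp
      then show False using that by (simp add: U_def)
    qed
    show "E i j * E k l = (if j = k then E i l else 0)"
      if "i < n" "j < n" "k < n" "l < n" for i j k l
      by (rule inj_onD[OF inj]) (use that closed E zero in \<open>auto simp: mult UU \<phi>0\<close>)
    show "E i j * x * E k l = \<phi> x $$ (j, k) *s E i l"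
      if "i < n" "j < n" "k < n" "l < n" "x \<in> B" for i j k l x
      by (rule inj_onD[OF inj]) (use that closed E car in \<open>auto simp: mult smult MU\<close>)
    show "\<exists>j<n. \<exists>k<n. \<phi> x $$ (j, k) \<noteq> 0" if x: "x \<in> B" "x \<noteq> 0" for x
    proof (rule ccontr)
      assume "\<not> ?thesis"
      then have "\<phi> x = \<phi> 0" using car[OF x(1)] by (auto simp: \<phi>0 intro!: eq_matI)
      then show False using inj_onD[OF inj _ x(1) zero] x by blast
    qed
  qed
  then show thesis by (rule that)
qed

section \<open>The commutant of a finite set\<close>

definition commutant :: "'a::ring set \<Rightarrow> 'a set" where
  "commutant S = {x. \<forall>s\<in>S. x * s = s * x}"

context matrix_unit_system
begin

text \<open>The element \<open>t\<close> need not lie in \<open>B\<close>. Its corner at \<open>E p p\<close> is copied to all diagonal positions, which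
  embeds that corner into the commutant of \<open>B\<close>.\<close>

definition ampliation :: "nat \<Rightarrow> 'a \<Rightarrow> 'a" where
  "ampliation p t = (\<Sum>j<n. E j p * t * E p j)"

lemma unit_ampliation:
  assumes "a < n" "b < n" "p < n"
  shows "E a b * ampliation p t = E a p * t * E p b"
    and "ampliation p t * E a b = E a p * t * E p b"
proof -
  have "E a b * ampliation p t = (\<Sum>j<n. if j = b then E a p * t * E p b else 0)"
    unfolding ampliation_def sum_distrib_left
    by (rule sum.cong) (use assms in \<open>auto simp: unit_mult simp flip: mult.assoc\<close>)
  then show "E a b * ampliation p t = E a p * t * E p b" using assms by simp
  have "ampliation p t * E a b = (\<Sum>j<n. if j = a then E a p * t * E p b else 0)"
    unfolding ampliation_def sum_distrib_right
    by (rule sum.cong) (use assms in \<open>auto simp: unit_mult mult.assoc\<close>)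
  then show "ampliation p t * E a b = E a p * t * E p b" using assms by simp
qed

lemma commutant_of_units:
  assumes "\<And>i j. i < n \<Longrightarrow> j < n \<Longrightarrow> x * E i j = E i j * x"
  shows "x \<in> commutant B"
proof -
  have "x * b = b * x" if b: "b \<in> B" for b
  proof -
    have "b = (\<Sum>i<n. E i i) * b * (\<Sum>j<n. E j j)"
      using unity_neutral[OF b] by (simp add: unity_def)
    also have "\<dots> = (\<Sum>i<n. \<Sum>j<n. coef b i j *s E i j)"
      using b by (simp add: sum_distrib_left sum_distrib_right unit_sandwich) (rule sum.swap)
    finally have b_eq: "b = (\<Sum>i<n. \<Sum>j<n. coef b i j *s E i j)" .
    show ?thesis
      by (subst (1 2) b_eq)
        (simp add: sum_distrib_left sum_distrib_right scale_mult_left scale_mult_right assms)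
  qed
  then show ?thesis by (simp add: commutant_def)
qed

end

context locally_matrix_algebra
begin

text \<open>Put \<open>S\<close> into a matrix subalgebra \<open>B\<close> of size \<open>n\<close>, and \<open>B\<close> into a much larger one, \<open>M\<close>. The unit of \<open>M\<close> is
  the sum of \<open>n + 1\<close> orthogonal idempotents: the diagonal units of \<open>B\<close> and the difference of the units
  of \<open>M\<close> and \<open>B\<close>, which may well be distinct. The corner of \<open>M\<close> at each of them embeds into the
  commutant of \<open>S\<close>, by ampliation for the units of \<open>B\<close> and by inclusion for the last one. If that
  commutant were commutative, all these corners would be at most one-dimensional, the rectangular ones
  too, and \<open>M\<close> would have dimension at most \<open>(n + 1)\<^sup>2\<close>.\<close>

lemma commutant_finite_noncommutative:
  fixes S :: "'b set"
  assumes large: "\<And>N. \<exists>I. finite I \<and> independent I \<and> card I > N"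
    and S: "finite S"
  shows "\<exists>x\<in>commutant S. \<exists>z\<in>commutant S. x * z \<noteq> z * x"
proof (rule ccontr)
  assume "\<not> ?thesis"
  then have comm: "x * z = z * x" if "x \<in> commutant S" "z \<in> commutant S" for x z
    using that by blast
  obtain B n \<phi> where "S \<subseteq> B" "subalgebra B" "matrix_iso n B \<phi>"
    using locally_matrix[OF S] by blast
  moreover obtain E coef where "matrix_unit_system scale B n E coef"
    using matrix_unit_system_of_matrix_iso calculation(2,3) .
  ultimately interpret B: matrix_unit_system scale B n E coef by blast
  obtain I where I: "finite I" "independent I" "card I > card ({..n} \<times> {..n})"
    using large by blast
  obtain M m \<psi> where sub: "I \<union> (\<lambda>(i, j). E i j) ` ({..<n} \<times> {..<n}) \<subseteq> M"
      and "subalgebra M" "matrix_iso m M \<psi>"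
    using locally_matrix[of "I \<union> (\<lambda>(i, j). E i j) ` ({..<n} \<times> {..<n})"] I by auto
  then obtain G coef' where "matrix_unit_system scale M m G coef'"
    using matrix_unit_system_of_matrix_iso by blast
  then interpret M: matrix_unit_system scale M m G coef' .
  have E_M: "E i j \<in> M" if "i < n" "j < n" for i j using sub that by auto
  have commS: "x \<in> commutant S" if "\<And>i j. i < n \<Longrightarrow> j < n \<Longrightarrow> x * E i j = E i j * x" for x
    using B.commutant_of_units[OF that] \<open>S \<subseteq> B\<close> by (auto simp: commutant_def)
  define f where "f p = (if p < n then E p p else M.unity - B.unity)" for p
  have e_M: "B.unity \<in> M" unfolding B.unity_def by (intro M.closed E_M) auto
  have f_M: "f p \<in> M" for p
    unfolding f_def using E_M M.closed M.unity_mem e_M by auto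
  \<comment> \<open>the corner at each f p is commutative, being embedded in the commutant of S\<close>
  have f_comm: "(f p * s * f p) * (t * f p) = (f p * t * f p) * (s * f p)"
    if st: "s \<in> M" "t \<in> M" for p s t
  proof (cases "p < n")
    case True
    have "B.ampliation p t \<in> commutant S" for t
      by (rule commS) (use True in \<open>simp add: B.unit_ampliation\<close>)
    then have "E p p * (B.ampliation p s * B.ampliation p t) * E p p
        = E p p * (B.ampliation p t * B.ampliation p s) * E p p" using comm by simp
    moreover have "E p p * (B.ampliation p s * B.ampliation p t) * E p p
        = (E p p * s * E p p) * (E p p * t * E p p)" for s t
    proof -
      have "E p p * (B.ampliation p s * B.ampliation p t) * E p p
          = (E p p * B.ampliation p s) * (B.ampliation p t * E p p)" by (simp add: mult.assoc)
      then show ?thesis using True by (simp add: B.unit_ampliation)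
    qed
    ultimately have "(E p p * s * E p p) * (E p p * t * E p p)
        = (E p p * t * E p p) * (E p p * s * E p p)" by simp
    moreover have "(E p p * s * E p p) * (E p p * t * E p p) = (E p p * s * E p p) * (t * E p p)"
      for s t
      using True by (simp add: mult.assoc B.unit_mult flip: mult.assoc[of "E p p" "E p p"])
    ultimately show ?thesis using True by (simp add: f_def)
  next
    case False
    let ?h = "M.unity - B.unity"
    have h0: "E i j * ?h = 0" "?h * E i j = 0" if "i < n" "j < n" for i j
      using that E_M B.unit_unity M.unity_neutral by (simp_all add: algebra_simps)
    have h: "?h * s * ?h \<in> commutant S" for s
      by (rule commS) (simp add: h0 mult.assoc flip: mult.assoc[of "E _ _"])
    have c: "(?h * s * ?h) * (?h * t * ?h) = (?h * t * ?h) * (?h * s * ?h)"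
      by (rule comm[OF h h])
    have "B.unity * B.unity = B.unity" using B.unity_neutral B.unity_mem by blast
    then have "?h * ?h = ?h"
      using M.unity_neutral[OF e_M] M.unity_neutral[OF M.unity_mem]
      by (simp add: algebra_simps)
    then have "(?h * s * ?h) * (?h * t * ?h) = (?h * s * ?h) * (t * ?h)" for s t
      by (simp add: mult.assoc flip: mult.assoc[of ?h ?h])
    with c show ?thesis using False by (simp add: f_def)
  qed
  have f_scalar: "\<exists>c. f p * s * f p = c *s f p" if "s \<in> M" for p s
    using M.corner_scalar[OF f_M f_comm that] .
  have "\<forall>p q. \<exists>u. \<forall>z\<in>M. \<exists>c. f p * z * f q = c *s u"
    using M.corner_rank_one[OF f_M f_M f_scalar f_scalar] by blast
  then obtain u where u: "\<And>p q z. z \<in> M \<Longrightarrow> \<exists>c. f p * z * f q = c *s u p q" by metis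
  let ?T = "(\<lambda>(p, q). u p q) ` ({..n} \<times> {..n})"
  have "(\<Sum>p<n. f p) = B.unity" by (simp add: f_def B.unity_def)
  then have f_sum: "(\<Sum>p\<le>n. f p) = M.unity"
    by (simp add: lessThan_Suc_atMost[symmetric] f_def)
  \<comment> \<open>the two-sided Peirce decomposition of M along the idempotents f p\<close>
  have "M \<subseteq> span ?T"
  proof
    fix z assume z: "z \<in> M"
    have "z = (\<Sum>p\<le>n. f p) * z * (\<Sum>q\<le>n. f q)" using M.unity_neutral[OF z] by (simp add: f_sum)
    also have "\<dots> = (\<Sum>p\<le>n. \<Sum>q\<le>n. f p * z * f q)"
      by (simp only: sum_distrib_left sum_distrib_right) (rule sum.swap)
    also have "\<dots> \<in> span ?T"
    proof (intro span_sum)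
      fix p q assume pq: "p \<in> {..n}" "q \<in> {..n}"
      obtain c where "f p * z * f q = c *s u p q" using u[OF z] by blast
      moreover have "u p q \<in> ?T" using pq by blast
      ultimately show "f p * z * f q \<in> span ?T" by (simp add: span_base span_scale)
    qed
    finally show "z \<in> span ?T" .
  qed
  then have "card I \<le> card ?T"
    using independent_span_bound[of ?T I] I sub by auto
  also have "\<dots> \<le> card ({..n} \<times> {..n})" by (rule card_image_le) simp
  finally show False using I(3) by simp
qed

end

section \<open>Infinite sums of inner derivations\<close>

text \<open>The \<open>i\<close>-th partner \<open>z i\<close> detects \<open>x i\<close> and no other \<open>x j\<close>. The last condition makes the infinite sum of
  inner derivations \<open>ad (x i)\<close> finite at every element, and it makes an inner derivation invisible to
  \<open>z i\<close> for large \<open>i\<close>.\<close>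

locale noncommuting_pairs = associative_algebra scale
  for scale :: "'f::field \<Rightarrow> 'a::ring \<Rightarrow> 'a" (infixr \<open>*s\<close> 75) +
  fixes x z :: "nat \<Rightarrow> 'a"
  assumes pair: "x i * z i \<noteq> z i * x i"
    and cross: "i \<noteq> j \<Longrightarrow> x i * z j = z j * x i"
    and eventually_commuting: "\<exists>k. \<forall>i\<ge>k. x i * y = y * x i \<and> z i * y = y * z i"
begin

text \<open>The infinite sum of the \<open>a i\<close> multiples of \<open>ad (x i)\<close>. The index set is cut down to the nonzero
  commutators, of which there are finitely many.\<close>

definition ad_series :: "(nat \<Rightarrow> 'f) \<Rightarrow> 'a \<Rightarrow> 'a" where
  "ad_series a y = (\<Sum>i | x i * y \<noteq> y * x i. a i *s (x i * y - y * x i))"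

lemma ad_series_eq:
  assumes "finite F" and "\<And>i. i \<notin> F \<Longrightarrow> x i * y = y * x i"
  shows "ad_series a y = (\<Sum>i\<in>F. a i *s (x i * y - y * x i))"
  unfolding ad_series_def by (rule sum.mono_neutral_left) (use assms in auto)

lemma common_support:
  assumes "finite Y"
  obtains F where "finite F" "\<And>i y. y \<in> Y \<Longrightarrow> i \<notin> F \<Longrightarrow> x i * y = y * x i"
proof -
  have "finite (\<Union>y\<in>Y. {i. x i * y \<noteq> y * x i})"
  proof (rule finite_UN_I[OF assms])
    fix y
    obtain k where "\<forall>i\<ge>k. x i * y = y * x i" using eventually_commuting by blast
    then have "{i. x i * y \<noteq> y * x i} \<subseteq> {..<k}" by (auto simp: not_le[symmetric])
    then show "finite {i. x i * y \<noteq> y * x i}" by (rule finite_subset) simp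
  qed
  then show thesis by (rule that) blast
qed

lemma derivation_ad_series: "derivation (ad_series a)"
  unfolding derivation_iff
proof (intro conjI allI)
  fix y w :: 'a and c
  obtain F where F: "finite F"
    "\<And>i v. v \<in> {y, w, y + w, y * w, c *s y} \<Longrightarrow> i \<notin> F \<Longrightarrow> x i * v = v * x i"
    using common_support[of "{y, w, y + w, y * w, c *s y}"] by auto
  note eq = ad_series_eq[OF F(1), of _ a]
  have sums: "ad_series a y = (\<Sum>i\<in>F. a i *s (x i * y - y * x i))"
    "ad_series a w = (\<Sum>i\<in>F. a i *s (x i * w - w * x i))"
    by (rule eq; use F(2) in blast)+
  have "ad_series a (y + w) = (\<Sum>i\<in>F. a i *s (x i * (y + w) - (y + w) * x i))"
    by (rule eq) (use F(2) in blast)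
  also have "\<dots> = ad_series a y + ad_series a w"
    unfolding sums sum.distrib[symmetric] scale_right_distrib[symmetric]
    by (intro sum.cong refl) (simp add: algebra_simps)
  finally show "ad_series a (y + w) = ad_series a y + ad_series a w" .
  have "ad_series a (c *s y) = (\<Sum>i\<in>F. a i *s (x i * (c *s y) - (c *s y) * x i))"
    by (rule eq) (use F(2) in blast)
  also have "\<dots> = c *s ad_series a y"
    unfolding sums scale_sum_right
    by (intro sum.cong refl)
      (simp add: scale_mult_left scale_mult_right scale_right_diff_distrib mult.commute)
  finally show "ad_series a (c *s y) = c *s ad_series a y" .
  have "ad_series a (y * w) = (\<Sum>i\<in>F. a i *s (x i * (y * w) - (y * w) * x i))"
    by (rule eq) (use F(2) in blast)
  also have "\<dots> = ad_series a y * w + y * ad_series a w"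
    unfolding sums sum_distrib_left sum_distrib_right sum.distrib[symmetric]
      scale_mult_left scale_mult_right scale_right_distrib[symmetric]
    by (intro sum.cong refl) (simp add: algebra_simps)
  finally show "ad_series a (y * w) = ad_series a y * w + y * ad_series a w" .
qed

lemma ad_series_linear:
  "ad_series (\<lambda>i. \<Sum>j\<in>S. c j * a j i) y = (\<Sum>j\<in>S. c j *s ad_series (a j) y)"
proof -
  have "ad_series (\<lambda>i. \<Sum>j\<in>S. c j * a j i) y
      = (\<Sum>i | x i * y \<noteq> y * x i. \<Sum>j\<in>S. (c j * a j i) *s (x i * y - y * x i))"
    by (simp add: ad_series_def scale_sum_left)
  also have "\<dots> = (\<Sum>j\<in>S. \<Sum>i | x i * y \<noteq> y * x i. (c j * a j i) *s (x i * y - y * x i))"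
    by (rule sum.swap)
  finally show ?thesis by (simp add: ad_series_def scale_sum_right)
qed

text \<open>Evaluate at \<open>z i\<close>: the series gives \<open>a i\<close> times a nonzero commutator, while an inner derivation gives
  zero for large \<open>i\<close>.\<close>

lemma finite_support_if_inner:
  assumes "ad_series a \<in> Inder"
  shows "\<exists>k. \<forall>i\<ge>k. a i = 0"
proof -
  obtain y where y: "ad_series a = inner_derivation y" using assms unfolding Inder_def by blast
  obtain k where k: "\<And>i. i \<ge> k \<Longrightarrow> z i * y = y * z i" using eventually_commuting[of y] by blast
  have "a i = 0" if i: "i \<ge> k" for i
  proof -
    have "a i *s (x i * z i - z i * x i) = ad_series a (z i)"
      using ad_series_eq[of "{i}" "z i" a] cross by auto
    also have "\<dots> = 0" using k[OF i] by (simp add: y inner_derivation_def)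
    finally show ?thesis using pair[of i] by simp
  qed
  then show ?thesis by blast
qed

end

text \<open>Choose the pairs one after another, each in the commutant of the earlier pairs and of the first
  elements of a countable spanning set \<open>b\<close>; every element of the algebra then commutes with all late pairs.\<close>

lemma (in locally_matrix_algebra) noncommuting_pairs_exist:
  fixes b :: "nat \<Rightarrow> 'b"
  assumes large: "\<And>N. \<exists>I. finite I \<and> independent I \<and> card I > N"
    and b: "span (range b) = UNIV"
  shows "\<exists>x z. noncommuting_pairs scale x z"
proof -
  have "\<forall>S :: 'b set. \<exists>x z. finite S \<longrightarrow> x \<in> commutant S \<and> z \<in> commutant S \<and> x * z \<noteq> z * x"
    using commutant_finite_noncommutative[OF large] by blast
  then obtain X Z :: "'b set \<Rightarrow> 'b" where XZ: "\<And>S. finite S \<Longrightarrow> X S \<in> commutant S"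
      "\<And>S. finite S \<Longrightarrow> Z S \<in> commutant S" "\<And>S. finite S \<Longrightarrow> X S * Z S \<noteq> Z S * X S"
    by metis
  define T where "T = rec_nat {} (\<lambda>i T. {b i, X T, Z T} \<union> T)"
  have T_Suc: "T (Suc i) = {b i, X (T i), Z (T i)} \<union> T i" for i by (simp add: T_def)
  have fin: "finite (T i)" for i by (induction i) (simp_all add: T_def)
  have mono: "T i \<subseteq> T j" if "i \<le> j" for i j
    using that by (rule lift_Suc_mono_le[rotated]) (auto simp: T_Suc)
  have mem: "b i \<in> T j" "X (T i) \<in> T j" "Z (T i) \<in> T j" if "i < j" for i j
    using mono[of "Suc i" j] that by (auto simp: T_Suc)
  have comm: "X (T j) * y = y * X (T j)" "Z (T j) * y = y * Z (T j)" if "y \<in> T j" for j y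
    using XZ(1,2)[OF fin] that by (auto simp: commutant_def)
  have "noncommuting_pairs scale (\<lambda>i. X (T i)) (\<lambda>i. Z (T i))"
  proof unfold_locales
    show "X (T i) * Z (T i) \<noteq> Z (T i) * X (T i)" for i by (rule XZ(3)[OF fin])
    show "X (T i) * Z (T j) = Z (T j) * X (T i)" if "i \<noteq> j" for i j
      using that comm mem by (metis linorder_neqE_nat)
    show "\<exists>k. \<forall>i\<ge>k. X (T i) * y = y * X (T i) \<and> Z (T i) * y = y * Z (T i)" for y
    proof -
      have "y \<in> span (range b)" using b by simp
      then show ?thesis
      proof (induction rule: span_induct_alt)
        case base
        show ?case by simp
      next
        case (step c v w)
        then obtain i k where v: "v = b i"
          and k: "\<forall>i\<ge>k. X (T i) * w = w * X (T i) \<and> Z (T i) * w = w * Z (T i)" by blast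
        show ?case
        proof (intro exI allI impI)
          fix j assume j: "j \<ge> max (Suc i) k"
          then have "b i \<in> T j" by (intro mem) simp
          from comm[OF this] k j
          show "X (T j) * (c *s v + w) = (c *s v + w) * X (T j)
              \<and> Z (T j) * (c *s v + w) = (c *s v + w) * Z (T j)"
            by (simp add: v algebra_simps scale_mult_left scale_mult_right)
        qed
      qed
    qed
  qed
  then show ?thesis by blast
qed

section \<open>The dimensions of Der and Outder\<close>

context associative_algebra
begin

lemma finsum_algebra_module: "finsum (algebra_module scale) f A = sum f A"
proof -
  interpret V: vectorspace class_ring "algebra_module scale" by (rule vectorspace_algebra_module)
  have zero: "\<zero>\<^bsub>algebra_module scale\<^esub> = 0" by (simp add: algebra_module_def)
  show ?thesis
  proof (induction A rule: infinite_finite_induct)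
    case (insert x A)
    then show ?case
      by (subst V.M.finsum_insert) (auto simp: algebra_module_def)
  qed (simp_all add: zero)
qed

lemma basis_algebra_module:
  assumes "vectorspace.basis class_ring (algebra_module scale) X"
  shows "independent X" and "span X = UNIV"
proof -
  interpret V: vectorspace class_ring "algebra_module scale" by (rule vectorspace_algebra_module)
  have lincomb: "V.lincomb u S = (\<Sum>v\<in>S. u v *s v)" for u S
    unfolding V.lincomb_def finsum_algebra_module by (simp add: algebra_module_def)
  have car: "carrier (algebra_module scale) = UNIV" and zero: "\<zero>\<^bsub>algebra_module scale\<^esub> = 0"
    by (simp_all add: algebra_module_def)
  have X: "V.lin_indpt X" "V.span X = UNIV"
    using assms unfolding V.basis_def car by blast+
  show "independent X"
    using X(1) unfolding dependent_explicit V.lin_dep_def lincomb zero by auto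
  have "v \<in> span X" for v
  proof -
    have "v \<in> V.span X" using X(2) by simp
    then obtain u S where "S \<subseteq> X" "v = (\<Sum>w\<in>S. u w *s w)"
      unfolding V.span_def lincomb by blast
    then show ?thesis by (auto intro!: span_sum span_scale intro: span_base)
  qed
  then show "span X = UNIV" by blast
qed

lemma finsum_Der:
  assumes "finite S" and "\<And>i. i \<in> S \<Longrightarrow> derivation (d i)"
  shows "(\<Oplus>\<^bsub>Der scale\<^esub>i\<in>S. c i \<odot>\<^bsub>Der scale\<^esub> d i) = (\<lambda>y. \<Sum>i\<in>S. c i *s d i y)"
proof -
  interpret V: vectorspace class_ring "Der scale" by (rule vectorspace_Der)
  have mem: "c i \<odot>\<^bsub>Der scale\<^esub> d i \<in> carrier (Der scale)" if "i \<in> S" for i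
    using that assms(2) by (intro V.smult_closed) (auto simp: Der_def)
  show ?thesis
    using assms(1) mem
  proof (induction S rule: finite_induct)
    case (insert i S)
    then have "(\<Oplus>\<^bsub>Der scale\<^esub>i\<in>insert i S. c i \<odot>\<^bsub>Der scale\<^esub> d i)
        = c i \<odot>\<^bsub>Der scale\<^esub> d i \<oplus>\<^bsub>Der scale\<^esub> (\<Oplus>\<^bsub>Der scale\<^esub>i\<in>S. c i \<odot>\<^bsub>Der scale\<^esub> d i)"
      by (intro V.M.finsum_insert Pi_I) auto
    also have "\<dots> = c i \<odot>\<^bsub>Der scale\<^esub> d i \<oplus>\<^bsub>Der scale\<^esub> (\<lambda>y. \<Sum>i\<in>S. c i *s d i y)"
      using insert.IH insert.prems by simp
    also have "\<dots> = (\<lambda>y. \<Sum>i\<in>insert i S. c i *s d i y)"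
      using insert.hyps by (auto simp: Der_def)
    finally show ?case .
  next
    case empty
    show ?case by (simp add: Der_def V.M.finsum_empty[unfolded Der_def])
  qed
qed

text \<open>A derivation is determined by its values on a countable basis, and each value by its countable
  sequence of coordinates; the resulting double sequence is a single one.\<close>

lemma card_of_Der:
  fixes b :: "nat \<Rightarrow> 'a"
  assumes indep: "independent (range b)" and span: "span (range b) = UNIV"
  shows "|carrier (Der scale)| \<le>o |UNIV :: (nat \<Rightarrow> 'f) set|"
proof -
  interpret P: vector_space_pair scale scale by unfold_locales
  define coord where "coord y n = representation (range b) y (b n)" for y n
  have coord_inj: "y = w" if "\<And>n. coord y n = coord w n" for y w
  proof -
    have "representation (range b) y v = representation (range b) w v" for v
    proof (cases "v \<in> range b")
      case True
      then show ?thesis using that by (auto simp: coord_def)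
    next
      case False
      then show ?thesis using representation_ne_zero by metis
    qed
    then have "representation (range b) y = representation (range b) w" by blast
    then show ?thesis
      using sum_nonzero_representation_eq[OF indep] span by (metis UNIV_I)
  qed
  define code where "code d m = (case prod_decode m of (i, j) \<Rightarrow> coord (d (b i)) j)" for d m
  have "inj_on code (carrier (Der scale))"
  proof (rule inj_onI, rule ext)
    fix d d' y assume "d \<in> carrier (Der scale)" "d' \<in> carrier (Der scale)" and eq: "code d = code d'"
    then have lin: "Vector_Spaces.linear scale scale d" "Vector_Spaces.linear scale scale d'"
      by (simp_all add: Der_def derivation_def)
    have "d (b i) = d' (b i)" for i
    proof (rule coord_inj)
      show "coord (d (b i)) j = coord (d' (b i)) j" for j
        using fun_cong[OF eq, of "prod_encode (i, j)"] by (simp add: code_def)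
    qed
    then show "d y = d' y"
      by (intro P.linear_eq_on_span[OF lin, of "range b" y]) (auto simp: span)
  qed
  then show ?thesis using card_of_ordLeq by blast
qed

end

text \<open>The series whose coefficients are the word sequences form the large family: a combination of them is
  again a series, so if it is inner its coefficients vanish from some position on, and
  then all the scalars are zero.\<close>

lemma (in noncommuting_pairs) dimension_Der_Outder:
  assumes "|carrier (Der scale)| \<le>o |UNIV :: (nat \<Rightarrow> 'f) set|"
  shows "dimension (class_ring :: 'f ring) (Der scale) =o |UNIV :: (nat \<Rightarrow> 'f) set|"
    and "dimension (class_ring :: 'f ring) (Outder scale) =o |UNIV :: (nat \<Rightarrow> 'f) set|"
proof -
  let ?v = "\<lambda>a :: nat \<Rightarrow> 'f. ad_series (word_sequence a)"
  have "inj (\<lambda>n m. if m = n then 1 else 0 :: 'f)"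
    by (rule injI) (metis zero_neq_one)
  then have inf: "infinite (UNIV :: (nat \<Rightarrow> 'f) set)"
    using infinite_UNIV_nat finite_imageD finite_subset subset_UNIV by metis
  have mem: "?v ` UNIV \<subseteq> carrier (Der scale)" using derivation_ad_series by (auto simp: Der_def)
  have indep: "\<forall>a\<in>S. c a = \<zero>\<^bsub>(class_ring :: 'f ring)\<^esub>"
    if S: "finite S"
      and inner: "(\<Oplus>\<^bsub>Der scale\<^esub>a\<in>S. c a \<odot>\<^bsub>Der scale\<^esub> ?v a) \<in> Inder" for S c
  proof -
    have "ad_series (\<lambda>i. \<Sum>a\<in>S. c a * word_sequence a i) \<in> Inder"
      using inner S derivation_ad_series by (simp add: finsum_Der ad_series_linear[abs_def])
    then obtain k where "\<forall>i\<ge>k. (\<Sum>a\<in>S. c a * word_sequence a i) = 0"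
      using finite_support_if_inner by blast
    then have "c a = 0" if "a \<in> S" for a
      using word_sequences_independent[OF S _ that] by blast
    then show ?thesis by simp
  qed
  note dims = dimension_quotient_eq_of_family[OF vectorspace_Der submodule_Inder inf mem assms indep]
  show "dimension (class_ring :: 'f ring) (Der scale) =o |UNIV :: (nat \<Rightarrow> 'f) set|"
    by (rule dims(1))
  show "dimension (class_ring :: 'f ring) (Outder scale) =o |UNIV :: (nat \<Rightarrow> 'f) set|"
    unfolding Outder_def by (rule dims(2))
qed

lemma card_of_sequences: "|UNIV :: (nat \<Rightarrow> 'f) set| =o |UNIV :: 'f set| ^c natLeq"
proof -
  have "|UNIV :: 'f set| ^c natLeq = |Func (UNIV :: nat set) (UNIV :: 'f set)|"
    by (simp add: cexp_def Field_natLeq)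
  also have "Func (UNIV :: nat set) (UNIV :: 'f set) = UNIV" by (auto simp: Func_def)
  finally show ?thesis by (simp add: card_of_refl)
qed

theorem theorem7:
  fixes scale :: "'f::field \<Rightarrow> 'a::ring \<Rightarrow> 'a"
  assumes "locally_matrix_algebra scale"
    and "dimension (class_ring :: 'f ring) (algebra_module scale) =o natLeq"
  shows "dimension (class_ring :: 'f ring) (Der scale)
           =o dimension (class_ring :: 'f ring) (Outder scale)
       \<and> dimension (class_ring :: 'f ring) (Outder scale) =o |UNIV :: 'f set| ^c natLeq"
proof -
  interpret locally_matrix_algebra scale by fact
  interpret V: vectorspace "class_ring :: 'f ring" "algebra_module scale"
    by (rule vectorspace_algebra_module)
  define X where "X = (SOME X. V.basis X)"
  have "V.basis X" unfolding X_def using V.basis_exists by (rule someI_ex)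
  note X = basis_algebra_module[OF this]
  have "|X| =o natLeq" using assms(2) unfolding dimension_def X_def .
  then have "|UNIV :: nat set| =o |X|"
    using card_of_nat ordIso_symmetric ordIso_transitive by blast
  then obtain b :: "nat \<Rightarrow> 'a" where b: "bij_betw b UNIV X" using card_of_ordIso by blast
  then have range_b: "range b = X" by (simp add: bij_betw_def)
  have "infinite X" using b bij_betw_finite infinite_UNIV_nat by blast
  have "\<exists>I. finite I \<and> independent I \<and> card I > N" for N
  proof -
    obtain I where "finite I" "card I = Suc N" "I \<subseteq> X"
      using infinite_arbitrarily_large[OF \<open>infinite X\<close>] by blast
    then show ?thesis using independent_mono[OF X(1)] by auto
  qed
  moreover have "span (range b) = UNIV" using X range_b by simp
  ultimately obtain x z where "noncommuting_pairs scale x z"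
    using noncommuting_pairs_exist by blast
  then interpret noncommuting_pairs scale x z .
  have "|carrier (Der scale)| \<le>o |UNIV :: (nat \<Rightarrow> 'f) set|"
    using card_of_Der[of b] X range_b by simp
  note dims = dimension_Der_Outder[OF this]
  show ?thesis
    using dims card_of_sequences ordIso_symmetric ordIso_transitive by metis
qed

end
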